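(* Let $n,m$ be integers with $n\ge 2$ and $0\le m\le n-1$. Suppose $B^\ast$ is a bipartite graph with $n$ vertices and $m$ edges such that $\sigma_2(B^\ast)$ attains the maximum value of $\sigma_2$ among all bipartite graphs with $n$ vertices and $m$ edges. Then $B^\ast\cong K_{1,m}\cup S_{n-m-1}$, i.e. $B^\ast$ is the star with $m$ edges together with $n-m-1$ isolated vertices.
   Context: All graphs are finite, simple and undirected. For a graph $G$, $\sigma_2(G)=\sum_{v\in V(G)} d(v)^2$, where $d(v)$ is the degree of $v$. $S_t$ denotes the edgeless graph on $t$ vertices, and $\cup$ denotes disjoint union. *)

theory Defs
  imports "Graph_Theory.Graph_Theory"
begin

text \<open>
  A finite simple undirected graph is a \<open>pair_graph\<close>: a finite loop-free digraph without parallel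
  arcs whose arc relation is symmetric. Each undirected edge is thus represented by two opposite
  arcs, so that the degree of a vertex is its out-degree (equivalently its in-degree), while edges
  have to be counted as unordered pairs.
\<close>

definition undirected_edges :: "'a pair_pre_digraph \<Rightarrow> 'a set set" where
  "undirected_edges G = {{u, v} | u v. (u, v) \<in> parcs G}"

definition degree :: "'a pair_pre_digraph \<Rightarrow> 'a \<Rightarrow> nat" where
  "degree G v = out_degree (with_proj G) v"

definition sigma2 :: "'a pair_pre_digraph \<Rightarrow> nat" where
  "sigma2 G = (\<Sum>v\<in>pverts G. (degree G v)\<^sup>2)"

definition bipartite :: "'a pair_pre_digraph \<Rightarrow> bool" where
  "bipartite G \<longleftrightarrow> (\<exists>U W. pverts G = U \<union> W \<and> U \<inter> W = {} \<and> parcs G \<subseteq> U \<times> W \<union> W \<times> U)"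

definition bipartite_graphs :: "nat \<Rightarrow> nat \<Rightarrow> 'a pair_pre_digraph set" where
  "bipartite_graphs n m =
     {G. pair_graph G \<and> bipartite G \<and> card (pverts G) = n \<and> card (undirected_edges G) = m}"

definition complete_bipartite_graph :: "nat \<Rightarrow> nat \<Rightarrow> (nat + nat) pair_pre_digraph" where
  "complete_bipartite_graph a b =
     \<lparr> pverts = {..<a} <+> {..<b},
       parcs = Inl ` {..<a} \<times> Inr ` {..<b} \<union> Inr ` {..<b} \<times> Inl ` {..<a} \<rparr>"

definition edgeless_graph :: "nat \<Rightarrow> nat pair_pre_digraph" where
  "edgeless_graph t = \<lparr> pverts = {..<t}, parcs = {} \<rparr>"

definition disjoint_union ::
  "'a pair_pre_digraph \<Rightarrow> 'b pair_pre_digraph \<Rightarrow> ('a + 'b) pair_pre_digraph" where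
  "disjoint_union G H =
     \<lparr> pverts = pverts G <+> pverts H,
       parcs = map_prod Inl Inl ` parcs G \<union> map_prod Inr Inr ` parcs H \<rparr>"

definition graph_iso :: "'a pair_pre_digraph \<Rightarrow> 'b pair_pre_digraph \<Rightarrow> bool" where
  "graph_iso G H \<longleftrightarrow> digraph_iso (with_proj G) (with_proj H)"

lemma complete_bipartite_graph_K:
  "K\<^bsub>a,b\<^esub> (with_proj (complete_bipartite_graph a b))"
  unfolding complete_bipartite_digraph_pair_def
proof (intro conjI exI)
  show "pverts (complete_bipartite_graph a b) = Inl ` {..<a} \<union> Inr ` {..<b}"
    by (auto simp: complete_bipartite_graph_def)
qed (auto simp: complete_bipartite_graph_def card_image)

lemma degree_conv_neighbours: "degree G v = card {w. (v, w) \<in> parcs G}"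
proof -
  have "out_arcs (with_proj G) v = Pair v ` {w. (v, w) \<in> parcs G}"
    by (auto simp: out_arcs_def)
  then show ?thesis
    by (simp add: degree_def out_degree_def card_image inj_on_def)
qed

lemma graph_iso_conv:
  assumes "pair_graph G"
  shows "graph_iso G H \<longleftrightarrow>
    (\<exists>f. bij_betw f (pverts G) (pverts H) \<and> parcs H = map_prod f f ` parcs G)"
proof
  interpret pair_graph G by (rule assms)
  assume "graph_iso G H"
  then obtain h where h: "pre_digraph.digraph_isomorphism (with_proj G) h"
    and H: "with_proj H = app_iso h (with_proj G)"
    by (auto simp: graph_iso_def digraph_iso_def)
  have V: "pverts H = iso_verts h ` pverts G"
    and A: "parcs H = iso_arcs h ` parcs G" and T: "iso_tail h = fst" and D: "iso_head h = snd"
    using H by (simp_all add: with_proj_def app_iso_def)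
  have "iso_arcs h e = map_prod (iso_verts h) (iso_verts h) e" if "e \<in> parcs G" for e
    using h that T D by (cases e) (auto simp: pre_digraph.digraph_isomorphism_def intro: prod_eqI)
  then have "parcs H = map_prod (iso_verts h) (iso_verts h) ` parcs G"
    using A by auto
  moreover have "bij_betw (iso_verts h) (pverts G) (pverts H)"
    using h V by (auto simp: pre_digraph.digraph_isomorphism_def bij_betw_def)
  ultimately show "\<exists>f. bij_betw f (pverts G) (pverts H) \<and> parcs H = map_prod f f ` parcs G"
    by blast
next
  interpret pair_graph G by (rule assms)
  assume "\<exists>f. bij_betw f (pverts G) (pverts H) \<and> parcs H = map_prod f f ` parcs G"
  then obtain f where f: "bij_betw f (pverts G) (pverts H)"
    and A: "parcs H = map_prod f f ` parcs G" by blast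
  let ?h = "\<lparr> iso_verts = f, iso_arcs = map_prod f f, iso_head = snd, iso_tail = fst \<rparr>"
  have inj: "inj_on f (pverts G)" using f by (simp add: bij_betw_def)
  have "inj_on (map_prod f f) (parcs G)"
    by (rule inj_on_subset[OF map_prod_inj_on[OF inj inj]]) (auto dest: wellformed')
  then have "pre_digraph.digraph_isomorphism (with_proj G) ?h"
    using inj by (auto simp: pre_digraph.digraph_isomorphism_def wf_digraph_axioms)
  moreover have "with_proj H = app_iso ?h (with_proj G)"
    using f A by (simp add: with_proj_def app_iso_def bij_betw_def)
  ultimately show "graph_iso G H"
    unfolding graph_iso_def digraph_iso_def by blast
qed

end

theory Submission
  imports Defs
begin

text \<open>
  Write \<open>\<sigma>\<^sub>2\<close> as the sum of \<open>d(u) + d(w)\<close> over all edges \<open>uw\<close>. At most \<open>m\<close> edges meet \<open>{u, w}\<close>, and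
  only \<open>uw\<close> itself is counted twice, so every summand is at most \<open>m + 1\<close> and \<open>\<sigma>\<^sub>2 \<le> m (m + 1)\<close>.
  The star attains this bound. Equality forces any two edges to intersect, and in a bipartite graph
  pairwise intersecting edges all share one vertex.
\<close>

section \<open>Row and column counts of a finite relation\<close>

text \<open>Each \<open>u\<close> contributes its row count once per element of its row, so grouping
  the pairs of \<open>R\<close> by first coordinate yields the square. This turns a sum over
  vertices into a sum over edges.\<close>

lemma sum_card_Image_squared:
  assumes "finite U" "finite W" "R \<subseteq> U \<times> W"
  shows "(\<Sum>u\<in>U. (card (R `` {u}))\<^sup>2) = (\<Sum>(u, w)\<in>R. card (R `` {u}))"
proof -
  have "finite (R `` {u})" for u
    by (rule finite_subset[OF _ assms(2)]) (use assms(3) in auto)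
  then have "(\<Sum>u\<in>U. \<Sum>w\<in>R `` {u}. card (R `` {u}))
      = (\<Sum>(u, w)\<in>(SIGMA u:U. R `` {u}). card (R `` {u}))"
    using assms(1) by (intro sum.Sigma) auto
  also have "(SIGMA u:U. R `` {u}) = R"
    using assms(3) by auto
  finally show ?thesis by (simp add: power2_eq_square)
qed

lemma sum_card_Image_converse_squared:
  assumes "finite U" "finite W" "R \<subseteq> U \<times> W"
  shows "(\<Sum>w\<in>W. (card (R\<inverse> `` {w}))\<^sup>2) = (\<Sum>(u, w)\<in>R. card (R\<inverse> `` {w}))"
proof -
  have "(\<Sum>w\<in>W. (card (R\<inverse> `` {w}))\<^sup>2) = (\<Sum>(w, u)\<in>R\<inverse>. card (R\<inverse> `` {w}))"
    using assms by (intro sum_card_Image_squared[of W U]) auto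
  also have "\<dots> = (\<Sum>(u, w)\<in>R. card (R\<inverse> `` {w}))"
    by (rule sum.reindex_bij_witness[where i = prod.swap and j = prod.swap]) auto
  finally show ?thesis .
qed

text \<open>Inclusion-exclusion: the row of \<open>u\<close> and the column of \<open>w\<close>,
  viewed as subsets of \<open>R\<close>, overlap only in \<open>(u, w)\<close>, which accounts for
  the \<open>+ 1\<close>.\<close>

lemma card_row_plus_card_column:
  assumes "finite R" "(u, w) \<in> R"
  shows "card (R `` {u}) + card (R\<inverse> `` {w}) = card {(x, y) \<in> R. x = u \<or> y = w} + 1"
proof -
  let ?A = "Pair u ` (R `` {u})" and ?B = "(\<lambda>x. (x, w)) ` (R\<inverse> `` {w})"
  have fin: "finite ?A" "finite ?B"
    using assms by (auto intro: finite_subset[of _ R])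
  have "card ?A = card (R `` {u})" "card ?B = card (R\<inverse> `` {w})"
    by (auto simp: card_image inj_on_def)
  moreover have "?A \<union> ?B = {(x, y) \<in> R. x = u \<or> y = w}" "?A \<inter> ?B = {(u, w)}"
    using assms by auto
  ultimately show ?thesis
    using card_Un_Int[OF fin] by simp
qed

lemma card_row_plus_card_column_le:
  assumes "finite R" "(u, w) \<in> R"
  shows "card (R `` {u}) + card (R\<inverse> `` {w}) \<le> card R + 1"
proof -
  have "card {(x, y) \<in> R. x = u \<or> y = w} \<le> card R"
    by (rule card_mono[OF assms(1)]) auto
  then show ?thesis
    using card_row_plus_card_column[OF assms] by simp
qed

lemma card_row_plus_card_column_less:
  assumes "finite R" "(u, w) \<in> R" "(x, y) \<in> R" "x \<noteq> u" "y \<noteq> w"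
  shows "card (R `` {u}) + card (R\<inverse> `` {w}) < card R + 1"
proof -
  have "card {(x, y) \<in> R. x = u \<or> y = w} < card R"
    using assms by (intro psubset_card_mono) auto
  then show ?thesis
    using card_row_plus_card_column[OF assms(1,2)] by simp
qed

text \<open>If some \<open>(x, w)\<close> leaves the row of \<open>u\<close>, then a pair meeting
  both \<open>(u, w)\<close> and \<open>(x, w)\<close> cannot have first coordinate \<open>u\<close>
  and \<open>x\<close> at once, so it lies in column \<open>w\<close>. Triangles do not arise
  because the two coordinates are never compared with each other.\<close>

lemma pairwise_meeting_pairs_in_line:
  assumes "\<And>u w x y. (u, w) \<in> R \<Longrightarrow> (x, y) \<in> R \<Longrightarrow> x = u \<or> y = w"
  obtains (empty) "R = {}"
    | (row) u L where "R = {u} \<times> L" "L \<noteq> {}"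
    | (column) w L where "R = L \<times> {w}" "L \<noteq> {}"
proof (cases "R = {}")
  case False
  then obtain u w where uw: "(u, w) \<in> R" by auto
  show ?thesis
  proof (cases "\<forall>(x, y)\<in>R. x = u")
    case True
    then have "R = {u} \<times> R `` {u}" by auto
    with uw row show ?thesis by blast
  next
    case False
    then obtain x where x: "(x, w) \<in> R" "x \<noteq> u"
      using assms[OF uw] by auto
    have "y = w" if "(z, y) \<in> R" for z y
      using assms[OF uw that] assms[OF x(1) that] x(2) by auto
    then have "R = R\<inverse> `` {w} \<times> {w}" by auto
    with uw column show ?thesis by blast
  qed
qed (use empty in blast)

section \<open>The sum of squared degrees of a bipartite graph\<close>

text \<open>\<open>R\<close> orients every edge from \<open>U\<close> to \<open>W\<close>, so each
  edge is counted once; degrees become row counts on \<open>U\<close> and column counts on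
  \<open>W\<close>.\<close>

context
  fixes G :: "'a pair_pre_digraph" and U W R
  assumes G: "pair_graph G"
    and parts: "pverts G = U \<union> W" "U \<inter> W = {}" "parcs G \<subseteq> U \<times> W \<union> W \<times> U"
  defines "R \<equiv> parcs G \<inter> U \<times> W"
begin

interpretation pair_graph G by (rule G)

lemma arc_sym: "(u, v) \<in> parcs G \<Longrightarrow> (v, u) \<in> parcs G"
  using graph_symmetric by (auto dest: symD)

lemma bipartite_parcs: "parcs G = R \<union> R\<inverse>"
  using parts arc_sym by (auto simp: R_def)

lemma finite_parts: "finite U" "finite W" "finite R"
  using finite_verts parts by (auto simp: R_def)

text \<open>As \<open>U\<close> and \<open>W\<close> are disjoint, an edge determines which of its
  ends lies in \<open>U\<close>, so forgetting the order is injective on \<open>R\<close>.\<close>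

lemma bipartite_card_edges: "card (undirected_edges G) = card R"
proof -
  have "undirected_edges G = (\<lambda>(u, w). {u, w}) ` R"
    using arc_sym unfolding undirected_edges_def bipartite_parcs by (force simp: insert_commute)
  moreover have "inj_on (\<lambda>(u, w). {u, w}) R"
    using parts by (auto simp: inj_on_def R_def doubleton_eq_iff)
  ultimately show ?thesis by (simp add: card_image)
qed

lemma bipartite_sigma2:
  "sigma2 G = (\<Sum>(u, w)\<in>R. card (R `` {u}) + card (R\<inverse> `` {w}))"
proof -
  have "degree G u = card (R `` {u})" if "u \<in> U" for u
    using that parts unfolding degree_conv_neighbours
    by (intro arg_cong[where f = card]) (auto simp: R_def)
  moreover have "degree G w = card (R\<inverse> `` {w})" if "w \<in> W" for w
    using that parts arc_sym unfolding degree_conv_neighbours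
    by (intro arg_cong[where f = card]) (auto simp: R_def)
  ultimately have "sigma2 G = (\<Sum>u\<in>U. (card (R `` {u}))\<^sup>2) + (\<Sum>w\<in>W. (card (R\<inverse> `` {w}))\<^sup>2)"
    unfolding sigma2_def using parts finite_parts by (simp add: sum.union_disjoint)
  moreover have "R \<subseteq> U \<times> W" by (simp add: R_def)
  ultimately show ?thesis
    using finite_parts
    by (simp add: sum_card_Image_squared sum_card_Image_converse_squared sum.distrib split_def)
qed

text \<open>Every summand of the edge sum is at most \<open>card R + 1\<close>. Two disjoint edges
  would make the summand at \<open>(u, w)\<close> strictly smaller and push \<open>sigma2 G\<close>
  below the assumed bound.\<close>

lemma bipartite_edges_meet_if_sigma2_ge:
  assumes "card R * (card R + 1) \<le> sigma2 G" "(u, w) \<in> R" "(x, y) \<in> R"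
  shows "x = u \<or> y = w"
proof (rule ccontr)
  assume "\<not> (x = u \<or> y = w)"
  then have "sigma2 G < (\<Sum>(u, w)\<in>R. card R + 1)"
    unfolding bipartite_sigma2
    using assms(2,3) finite_parts(3) card_row_plus_card_column_le[of R]
      card_row_plus_card_column_less[of R u w x y]
    by (intro sum_strict_mono_ex1 ballI bexI[of _ "(u, w)"]) auto
  then show False
    using assms(1) by (simp add: split_def)
qed

end

section \<open>Stars with isolated vertices\<close>

text \<open>The vertex set is a parameter so that a competing star can be built on the vertices of a
  given graph, within the same type. Vertices outside \<open>L\<close> and other than
  \<open>c\<close> are isolated.\<close>

definition star_graph :: "'a set \<Rightarrow> 'a \<Rightarrow> 'a set \<Rightarrow> 'a pair_pre_digraph" where
  "star_graph V c L = \<lparr> pverts = V, parcs = {c} \<times> L \<union> L \<times> {c} \<rparr>"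

lemma pair_graph_star_graph:
  assumes "finite V" "c \<in> V" "L \<subseteq> V - {c}"
  shows "pair_graph (star_graph V c L)"
  using assms finite_subset[of L V]
  by unfold_locales (auto simp: star_graph_def symmetric_def intro!: symI)

lemma bipartite_star_graph:
  assumes "c \<in> V" "L \<subseteq> V - {c}"
  shows "bipartite (star_graph V c L)"
  unfolding bipartite_def using assms
  by (intro exI[of _ "{c}"] exI[of _ "V - {c}"]) (auto simp: star_graph_def)

lemma card_undirected_edges_star_graph:
  assumes "c \<notin> L"
  shows "card (undirected_edges (star_graph V c L)) = card L"
proof -
  have "undirected_edges (star_graph V c L) = (\<lambda>v. {c, v}) ` L"
    by (auto simp: undirected_edges_def star_graph_def)
  moreover have "inj_on (\<lambda>v. {c, v}) L"
    using assms by (auto simp: inj_on_def doubleton_eq_iff)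
  ultimately show ?thesis by (simp add: card_image)
qed

text \<open>The centre contributes \<open>(card L)\<^sup>2\<close>, each leaf 1 and the remaining
  vertices 0, so the upper bound is attained.\<close>

lemma sigma2_star_graph:
  assumes "finite V" "c \<in> V" "L \<subseteq> V - {c}"
  shows "sigma2 (star_graph V c L) = card L * (card L + 1)"
proof -
  have deg: "degree (star_graph V c L) v = (if v = c then card L else if v \<in> L then 1 else 0)" for v
  proof -
    have "{w. (v, w) \<in> parcs (star_graph V c L)} = (if v = c then L else if v \<in> L then {c} else {})"
      using assms by (auto simp: star_graph_def)
    then show ?thesis by (simp add: degree_conv_neighbours)
  qed
  have "sigma2 (star_graph V c L) = (card L)\<^sup>2 + (\<Sum>v\<in>V - {c}. (degree (star_graph V c L) v)\<^sup>2)"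
    unfolding sigma2_def using assms
    by (subst sum.remove[of _ c]) (simp_all add: deg, simp_all add: star_graph_def)
  also have "(\<Sum>v\<in>V - {c}. (degree (star_graph V c L) v)\<^sup>2) = (\<Sum>v\<in>L. 1)"
    using assms by (intro sum.mono_neutral_cong_right) (auto simp: deg)
  finally show ?thesis by (simp add: power2_eq_square)
qed

lemma star_graph_iso:
  assumes "finite V" "c \<in> V" "L \<subseteq> V - {c}"
  shows "graph_iso (star_graph V c L)
    (disjoint_union (complete_bipartite_graph 1 (card L)) (edgeless_graph (card V - card L - 1)))"
proof -
  let ?I = "V - {c} - L"
  have fin: "finite L" "finite ?I"
    using assms finite_subset by auto
  have cardI: "card ?I = card V - card L - 1"
    using assms fin by (simp add: card_Diff_subset)
  obtain g where g: "bij_betw g L {..<card L}"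
    using ex_bij_betw_finite_nat[OF fin(1)] by (auto simp: atLeast0LessThan)
  obtain h where h: "bij_betw h ?I {..<card V - card L - 1}"
    using ex_bij_betw_finite_nat[OF fin(2)] by (auto simp: atLeast0LessThan cardI)
  \<comment> \<open>The centre goes to the one-vertex side of the complete bipartite graph, the
    leaves to its other side, and the isolated vertices to the edgeless summand.\<close>
  define f where "f v = (if v = c then Inl (Inl (0::nat))
    else if v \<in> L then Inl (Inr (g v)) else Inr (h v))" for v
  have fL: "f ` L = Inl ` Inr ` {..<card L}"
  proof -
    have "f ` L = Inl ` Inr ` g ` L"
      unfolding image_image using assms by (intro image_cong) (auto simp: f_def)
    then show ?thesis
      using g by (simp add: bij_betw_def)
  qed
  have fI: "f ` ?I = Inr ` {..<card V - card L - 1}"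
  proof -
    have "f ` ?I = Inr ` h ` ?I"
      unfolding image_image by (intro image_cong) (auto simp: f_def)
    then show ?thesis
      using h by (simp add: bij_betw_def)
  qed
  have "inj_on f V"
    using g h by (auto simp: f_def bij_betw_def inj_on_def)
  moreover have "V = insert c (L \<union> ?I)"
    using assms by auto
  then have "f ` V = insert (f c) (f ` L \<union> f ` ?I)"
    by (metis image_Un image_insert)
  then have "f ` V =
      ({..<1} <+> {..<card L}) <+> {..<card V - card L - 1}"
    unfolding fL fI by (auto simp: f_def)
  moreover have "map_prod f f ` ({c} \<times> L \<union> L \<times> {c}) = map_prod Inl Inl `
      (Inl ` {..<1} \<times> Inr ` {..<card L} \<union> Inr ` {..<card L} \<times> Inl ` {..<1})"
    unfolding map_prod_def image_Un image_paired_Times fL by (simp add: f_def lessThan_Suc)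
  ultimately show ?thesis
    unfolding graph_iso_conv[OF pair_graph_star_graph[OF assms]]
    by (intro exI[of _ f])
      (simp add: bij_betw_def star_graph_def disjoint_union_def complete_bipartite_graph_def
        edgeless_graph_def)
qed

lemma bipartite_star_graph_if_sigma2_ge:
  fixes G :: "'a pair_pre_digraph"
  assumes G: "pair_graph G" "bipartite G" "pverts G \<noteq> {}"
    and sigma2: "card (undirected_edges G) * (card (undirected_edges G) + 1) \<le> sigma2 G"
  obtains c L where "c \<in> pverts G" "L \<subseteq> pverts G - {c}" "G = star_graph (pverts G) c L"
proof -
  obtain U W where parts: "pverts G = U \<union> W" "U \<inter> W = {}" "parcs G \<subseteq> U \<times> W \<union> W \<times> U"
    using G(2) by (auto simp: bipartite_def)
  define R where "R = parcs G \<inter> U \<times> W"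
  note facts = G(1) parts
  have arcs: "parcs G = R \<union> R\<inverse>"
    using bipartite_parcs[OF facts] by (simp add: R_def)
  have meet: "x = u \<or> y = w" if "(u, w) \<in> R" "(x, y) \<in> R" for u w x y
    using bipartite_edges_meet_if_sigma2_ge[OF facts] that sigma2
    by (simp add: R_def bipartite_card_edges[OF facts])
  have eq: "G = star_graph (pverts G) c L" if "parcs G = {c} \<times> L \<union> L \<times> {c}" for c L
    using that by (simp add: star_graph_def)
  from meet show ?thesis
  proof (rule pairwise_meeting_pairs_in_line)
    assume "R = {}"
    \<comment> \<open>Without edges, any vertex serves as the centre of a star with no
      leaves.\<close>
    moreover obtain c where "c \<in> pverts G" using G(3) by blast
    ultimately show ?thesis
      using arcs by (intro that[of c "{}"] eq) auto
  next
    fix u L assume "R = {u} \<times> L" "L \<noteq> {}"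
    \<comment> \<open>That \<open>L\<close> is nonempty is what makes \<open>u\<close> a
      vertex.\<close>
    moreover from this have "u \<in> U" "L \<subseteq> W" by (auto simp: R_def)
    ultimately show ?thesis
      using parts arcs by (intro that[of u L] eq) auto
  next
    fix w L assume "R = L \<times> {w}" "L \<noteq> {}"
    moreover from this have "w \<in> W" "L \<subseteq> U" by (auto simp: R_def)
    ultimately show ?thesis
      using parts arcs by (intro that[of w L] eq) auto
  qed
qed

theorem theorem1:
  fixes n m :: nat and B :: "'a pair_pre_digraph"
  assumes "n \<ge> 2" and "m \<le> n - 1"
    and "B \<in> bipartite_graphs n m"
    and "\<forall>G \<in> (bipartite_graphs n m :: 'a pair_pre_digraph set). sigma2 G \<le> sigma2 B"
  shows "graph_iso B (disjoint_union (complete_bipartite_graph 1 m) (edgeless_graph (n - m - 1)))"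
proof -
  let ?V = "pverts B"
  have B: "pair_graph B" "bipartite B" "card ?V = n" "card (undirected_edges B) = m"
    using assms(3) by (auto simp: bipartite_graphs_def)
  have V: "finite ?V" "?V \<noteq> {}"
    using B(3) assms(1) card_ge_0_finite[of ?V] by auto
  then obtain c where c: "c \<in> ?V" by blast
  \<comment> \<open>The bound \<open>m \<le> n - 1\<close> leaves room for \<open>m\<close> leaves
    beside the centre. Comparison with this star forces \<open>B\<close> to reach the bound
    \<open>m * (m + 1)\<close>.\<close>
  obtain L where L: "L \<subseteq> ?V - {c}" "card L = m"
    using obtain_subset_with_card_n[of m "?V - {c}"] B(3) V c assms(2) by auto
  have "star_graph ?V c L \<in> bipartite_graphs n m"
    using V(1) c L B(3) pair_graph_star_graph bipartite_star_graph
      card_undirected_edges_star_graph[of c L ?V]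
    by (auto simp: bipartite_graphs_def star_graph_def)
  then have "m * (m + 1) \<le> sigma2 B"
    using assms(4) sigma2_star_graph[OF V(1) c L(1)] L(2) by fastforce
  then obtain c' L' where star: "c' \<in> ?V" "L' \<subseteq> ?V - {c'}" "B = star_graph ?V c' L'"
    using bipartite_star_graph_if_sigma2_ge[OF B(1,2) V(2)] B(4) by metis
  have "card L' = card (undirected_edges (star_graph ?V c' L'))"
    using star(2) by (intro card_undirected_edges_star_graph[symmetric]) auto
  also have "\<dots> = m"
    using B(4) star(3) by simp
  finally show ?thesis
    \<comment> \<open>\<open>B\<close> also occurs on the right of \<open>star(3)\<close>, inside
      \<open>?V\<close>, so that equation is used from right to left.\<close>
    using star_graph_iso[OF V(1) star(1,2)] B(3) by (simp flip: star(3))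
qed

end
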